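(* Let $f\in\mathcal{A}$ and let $\gamma\geq\beta>0$ be real numbers such that $4\gamma-\beta\geq 1$. If $f$ satisfies the subordination $$\gamma\frac{zf'(z)}{f(z)}\left(1+\frac{zf''(z)}{f'(z)}-\frac{zf'(z)}{f(z)}\right)+\beta\frac{zf'(z)}{f(z)}\left(\frac{z^2f'''(z)}{f'(z)}-\frac{3z^2f''(z)}{f(z)}+\frac{2zf''(z)}{f'(z)}+2\left(\frac{zf'(z)}{f(z)}\right)^2-\frac{2zf'(z)}{f(z)}\right)\prec\frac{z}{8\sqrt{2}},$$ then $f\in\mathcal{SL}$.
   Context: $\mathbb{D}=\{z\in\mathbb{C}:|z|<1\}$. $\mathcal{A}$ is the set of analytic functions $f$ on $\mathbb{D}$ with $f(0)=0$ and $f'(0)=1$. For analytic $f,g$ on $\mathbb{D}$, $f\prec g$ ($f$ is subordinate to $g$) means there is an analytic $w:\mathbb{D}\to\mathbb{D}$ with $w(0)=0$ and $f(z)=g(w(z))$ for all $z\in\mathbb{D}$; in particular the left-hand side of a subordination is understood to be an analytic function on $\mathbb{D}$ (after filling in removable singularities). $\mathcal{SL}$ (lemniscate starlike functions) is the class of $f\in\mathcal{A}$ with $zf'(z)/f(z)\prec\sqrt{1+z}$ (principal branch), i.e. $zf'(z)/f(z)$ takes values in $\{w:|w^2-1|<1,\ \operatorname{Re}w>0\}$ for $z\in\mathbb{D}$. *)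

theory Defs
  imports "HOL-Complex_Analysis.Complex_Analysis"
begin

abbreviation unit_disc :: "complex set" ("\<D>")
  where "\<D> \<equiv> ball 0 1"

definition class_A :: "(complex \<Rightarrow> complex) set"
  where "class_A = {f. f holomorphic_on \<D> \<and> f 0 = 0 \<and> deriv f 0 = 1}"

definition subordinate :: "(complex \<Rightarrow> complex) \<Rightarrow> (complex \<Rightarrow> complex) \<Rightarrow> bool"  (infix "\<prec>\<^sub>s" 50)
  where "f \<prec>\<^sub>s g \<longleftrightarrow>
    f holomorphic_on \<D> \<and> g holomorphic_on \<D> \<and>
    (\<exists>w. w holomorphic_on \<D> \<and> w \<in> \<D> \<rightarrow> \<D> \<and> w 0 = 0 \<and> (\<forall>z\<in>\<D>. f z = g (w z)))"

definition starlike_quot :: "(complex \<Rightarrow> complex) \<Rightarrow> complex \<Rightarrow> complex"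
  where "starlike_quot f z = z * deriv f z / f z"

text \<open>
  The quotient is undefined at the zeros of \<open>f\<close>, in particular at \<open>0\<close>, where division in HOL
  returns \<open>0\<close>. \<^const>\<open>remove_sings\<close> replaces the value at every point by the limit there, if
  it exists, and by \<open>0\<close> otherwise; at a pole the result is discontinuous, so the holomorphy
  required by \<^const>\<open>subordinate\<close> says that all singularities in the disc are removable.
\<close>

definition class_SL :: "(complex \<Rightarrow> complex) set"
  where "class_SL = {f \<in> class_A. remove_sings (starlike_quot f) \<prec>\<^sub>s (\<lambda>z. csqrt (1 + z))}"

end

theory Submission
  imports Defs
begin

text \<open>
  With \<open>p = z f' / f\<close> the left-hand side of the hypothesis is \<open>\<gamma> z p' + \<beta> z\<^sup>2 p''\<close>. At a zero of \<open>f\<close>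
  other than the origin this would have a triple pole, as \<open>\<beta> \<noteq> 0\<close>; hence \<open>p\<close> extends
  holomorphically to the disc. By Schwarz's lemma \<open>\<bar>\<gamma> p' + \<beta> z p''\<bar> \<le> M\<close> for
  \<open>M = 1 / (8 sqrt 2)\<close>, and integrating the derivative of \<open>t powr (\<gamma>/\<beta>) * p'(t z)\<close> over \<open>[0, 1]\<close>
  yields \<open>\<bar>p'\<bar> \<le> M / \<gamma>\<close>. Since \<open>\<gamma> > 1/4\<close>, it follows that \<open>\<bar>p - 1\<bar> < 4 M < 2/5 < sqrt 2 - 1\<close>, and the
  disc of radius \<open>sqrt 2 - 1\<close> about \<open>1\<close> is contained in the lemniscate region.
\<close>

text \<open>The derivative of \<open>t powr a * g (t z)\<close> is
  \<open>t powr (a - 1) / \<beta>\<close> times the bounded expression at \<open>t z\<close>, hence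
  dominated by the derivative of \<open>M / \<gamma> * t powr a\<close>. Applied below to
  \<open>g = deriv p\<close>.\<close>

lemma first_order_operator_bound:
  fixes g :: "complex \<Rightarrow> complex" and \<beta> \<gamma> M :: real
  assumes g: "g holomorphic_on \<D>" and pos: "\<beta> > 0" "\<gamma> > 0"
    and bound: "\<And>z. z \<in> \<D> \<Longrightarrow> norm (of_real \<gamma> * g z + of_real \<beta> * z * deriv g z) \<le> M"
    and z: "z \<in> \<D>"
  shows "norm (g z) \<le> M / \<gamma>"
proof -
  define a where "a = \<gamma> / \<beta>"
  have a: "a > 0" "a * \<beta> = \<gamma>" using pos by (auto simp: a_def)
  define F where "F = (\<lambda>t. of_real (t powr a) * g (of_real t * z))"
  define F' where "F' = (\<lambda>t. of_real (a * t powr (a - 1)) * g (of_real t * z)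
                        + of_real (t powr a) * (z * deriv g (of_real t * z)))"
  have in_disc: "of_real t * z \<in> \<D>" if "0 \<le> t" "t \<le> 1" for t :: real
    using that z mult_left_le_one_le[of "norm z" t]
    by (simp add: norm_mult le_less_trans[of _ "norm z"])
  \<comment> \<open>Since \<open>0 powr a = 0\<close>, also \<open>F 0 = 0\<close>, so comparing
    increments over the unit interval gives the claim.\<close>
  have "norm (F 1 - F 0) \<le> M / \<gamma> * 1 powr a - M / \<gamma> * 0 powr a"
  proof (rule differentiable_bound_general)
    show "(0::real) < 1" by simp
    have "continuous_on {0..1} (\<lambda>t. g (complex_of_real t * z))"
      by (rule continuous_on_compose2[OF holomorphic_on_imp_continuous_on[OF g]])
        (use in_disc in \<open>auto intro!: continuous_intros\<close>)
    then show "continuous_on {0..1} F"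
      unfolding F_def using a by (auto intro!: continuous_intros continuous_on_powr')
    show "continuous_on {0..1} (\<lambda>t. M / \<gamma> * t powr a)"
      using a by (intro continuous_on_mult_left continuous_on_powr' continuous_intros) auto
    fix t :: real assume t: "0 < t" "t < 1"
    let ?\<zeta> = "of_real t * z"
    show "((\<lambda>t. M / \<gamma> * t powr a) has_vector_derivative M / \<gamma> * (a * t powr (a - 1))) (at t)"
      unfolding has_real_derivative_iff_has_vector_derivative[symmetric]
      using t pos by (auto intro!: derivative_eq_intros)
    have dg: "(g has_field_derivative deriv g ?\<zeta>) (at ?\<zeta>)"
      by (rule holomorphic_derivI[OF g]) (use in_disc t in auto)
    have "((\<lambda>t. complex_of_real t * z) has_vector_derivative z) (at t)"
      by (auto intro!: derivative_eq_intros)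
    from field_vector_diff_chain_at[OF this dg]
    have "((\<lambda>t. g (of_real t * z)) has_vector_derivative z * deriv g ?\<zeta>) (at t)"
      by (simp add: o_def)
    moreover have "((\<lambda>t. complex_of_real (t powr a)) has_vector_derivative
        of_real (a * t powr (a - 1))) (at t)"
      by (rule has_vector_derivative_of_real)
        (use t in \<open>auto intro!: derivative_eq_intros\<close>)
    ultimately show "(F has_vector_derivative F' t) (at t)"
      unfolding F_def F'_def
      by (auto intro!: has_vector_derivative_eq_rhs[OF has_vector_derivative_mult])
    have eq: "F' t = of_real (t powr (a - 1) / \<beta>) *
        (of_real \<gamma> * g ?\<zeta> + of_real \<beta> * ?\<zeta> * deriv g ?\<zeta>)"
    proof -
      have "t powr a = t * t powr (a - 1)"
        using t by (simp add: powr_mult_base)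
      then show ?thesis
        unfolding F'_def a(2)[symmetric] using pos by (simp add: field_simps)
    qed
    have "norm (F' t) \<le> t powr (a - 1) / \<beta> * M"
      unfolding eq norm_mult using pos t z in_disc[of t]
      by (intro mult_mono bound) (auto simp: norm_divide)
    then show "norm (F' t) \<le> M / \<gamma> * (a * t powr (a - 1))"
      using pos by (simp add: a_def mult_ac)
  qed
  then show ?thesis using a by (simp add: F_def)
qed

text \<open>Copied verbatim from the hypothesis of the theorem, so that unfolding is enough to match
  it. Values at zeros of \<open>f\<close> or \<open>deriv f\<close> depend on division by zero and
  carry no meaning.\<close>

definition second_order_functional :: "real \<Rightarrow> real \<Rightarrow> (complex \<Rightarrow> complex) \<Rightarrow> complex \<Rightarrow> complex"
  where "second_order_functional \<gamma> \<beta> f z =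
           of_real \<gamma> * (z * deriv f z / f z) *
             (1 + z * (deriv ^^ 2) f z / deriv f z - z * deriv f z / f z)
         + of_real \<beta> * (z * deriv f z / f z) *
             (z ^ 2 * (deriv ^^ 3) f z / deriv f z - 3 * z ^ 2 * (deriv ^^ 2) f z / f z
              + 2 * z * (deriv ^^ 2) f z / deriv f z
              + 2 * (z * deriv f z / f z) ^ 2 - 2 * z * deriv f z / f z)"

text \<open>With \<open>P = z f' / f\<close>, the factor \<open>f'\<close> of \<open>P\<close>
  cancels every denominator \<open>f'\<close> in the brackets, leaving \<open>z P'\<close> and
  \<open>z^2 P''\<close>.\<close>

lemma second_order_functional_eq:
  assumes f: "f holomorphic_on S" "open S" "z \<in> S" and nz: "f z \<noteq> 0" "deriv f z \<noteq> 0"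
  shows "second_order_functional \<gamma> \<beta> f z =
    of_real \<gamma> * (z * deriv (starlike_quot f) z)
    + of_real \<beta> * (z\<^sup>2 * deriv (deriv (starlike_quot f)) z)"
proof -
  define T where "T = {w \<in> S. f w \<noteq> 0}"
  have T: "open T" "z \<in> T"
    using f nz continuous_open_preimage[OF holomorphic_on_imp_continuous_on[OF f(1)] f(2), of "- {0}"]
    by (auto simp: T_def vimage_def Int_def)
  let ?f1 = "deriv f" and ?f2 = "(deriv ^^ 2) f" and ?f3 = "(deriv ^^ 3) f"
  have D: "(f has_field_derivative ?f1 w) (at w)" "(?f1 has_field_derivative ?f2 w) (at w)"
      "(?f2 has_field_derivative ?f3 w) (at w)" if "w \<in> T" for w
    using that has_field_derivative_higher_deriv[OF f(1,2), of w 0]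
      has_field_derivative_higher_deriv[OF f(1,2), of w 1]
      has_field_derivative_higher_deriv[OF f(1,2), of w 2]
    by (auto simp: T_def numeral_2_eq_2 numeral_3_eq_3)
  \<comment> \<open>Reciprocals are treated as atoms, so that both derivatives become
    polynomials.\<close>
  let ?i = "\<lambda>w. inverse (f w)"
  let ?P' = "\<lambda>w. ?f1 w * ?i w + w * ?f2 w * ?i w - w * (?f1 w)\<^sup>2 * (?i w)\<^sup>2"
  have P_eq: "starlike_quot f = (\<lambda>w. w * ?f1 w * ?i w)"
    by (simp add: starlike_quot_def fun_eq_iff divide_inverse)
  have "deriv (starlike_quot f) w = ?P' w" if w: "w \<in> T" for w
  proof -
    have fw: "f w \<noteq> 0" using w by (simp add: T_def)
    show ?thesis
      unfolding P_eq by (rule DERIV_imp_deriv, (rule derivative_eq_intros D refl w fw)+)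
        (simp add: algebra_simps power2_eq_square)
  qed
  note P' = this
  then have "deriv (deriv (starlike_quot f)) z = deriv ?P' z"
    using T by (auto intro!: deriv_cong_ev eventually_nhds_in_open[THEN eventually_mono])
  also have "deriv ?P' z = 2 * ?f2 z * ?i z - 2 * (?f1 z)\<^sup>2 * (?i z)\<^sup>2 + z * ?f3 z * ?i z
     - 3 * z * ?f1 z * ?f2 z * (?i z)\<^sup>2 + 2 * z * (?f1 z) ^ 3 * (?i z) ^ 3"
    by (rule DERIV_imp_deriv, (rule derivative_eq_intros D refl T nz)+)
      (simp add: algebra_simps power2_eq_square power3_eq_cube)
  finally have P'': "deriv (deriv (starlike_quot f)) z = \<dots>" .
  \<comment> \<open>Modulo this relation the claim is a polynomial identity, which
    \<open>algebra\<close> decides.\<close>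
  have "?f1 z * inverse (?f1 z) = 1" using nz by simp
  then show ?thesis
    unfolding second_order_functional_def P'[OF T(2)] P'' divide_inverse by algebra
qed

text \<open>Logarithmic differentiation of \<open>f = (z - \<xi>)^n g\<close> gives
  \<open>f'/f = g'/g + n/(z - \<xi>)\<close>. The pole is thus at most simple with coefficient
  \<open>n \<xi>\<close>, which vanishes at the origin.\<close>

lemma starlike_quot_local_form:
  assumes f: "f holomorphic_on S" "open S" "connected S" "\<xi> \<in> S" and nz: "\<exists>w\<in>S. f w \<noteq> 0"
  obtains k r where "r > 0" "k holomorphic_on ball \<xi> r" "\<xi> = 0 \<Longrightarrow> k \<xi> = 0"
    "\<And>z. z \<in> ball \<xi> r - {\<xi>} \<Longrightarrow> starlike_quot f z = k z / (z - \<xi>)"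
proof -
  \<comment> \<open>The order is \<open>0\<close> where \<open>f\<close> does not vanish, so such
    points need no separate case.\<close>
  define n where "n = nat (zorder f \<xi>)"
  from zorder_exist_zero[OF f nz]
  obtain g r where r: "r > 0" "g holomorphic_on cball \<xi> r"
    and fg: "\<And>w. w \<in> cball \<xi> r \<Longrightarrow> f w = g w * (w - \<xi>) ^ n \<and> g w \<noteq> 0"
    unfolding n_def by blast
  define k where "k = (\<lambda>z. z * ((z - \<xi>) * deriv g z / g z + of_nat n))"
  have g: "g holomorphic_on ball \<xi> r" using r(2) by (rule holomorphic_on_subset) auto
  show ?thesis
  proof (rule that[of r k])
    show "k holomorphic_on ball \<xi> r"
      unfolding k_def using fg by (auto intro!: holomorphic_intros g)
    fix z assume z: "z \<in> ball \<xi> r - {\<xi>}"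
    have "deriv f z = deriv (\<lambda>w. g w * (w - \<xi>) ^ n) z"
      by (intro deriv_cong_ev eventually_nhds_in_open[THEN eventually_mono, of "ball \<xi> r"])
        (use z fg in auto)
    also have "\<dots> = deriv g z * (z - \<xi>) ^ n + g z * (of_nat n * (z - \<xi>) ^ (n - 1))"
      by (rule DERIV_imp_deriv)
        (use z in \<open>auto intro!: derivative_eq_intros holomorphic_derivI[OF g]\<close>)
    finally have f': "deriv f z = \<dots>" .
    define u where "u = z - \<xi>"
    have u: "u \<noteq> 0" using z by (simp add: u_def)
    \<comment> \<open>For \<open>n = 0\<close> the exponent truncates to \<open>0\<close>, but both
      sides vanish.\<close>
    have "of_nat n * u ^ (n - 1) = of_nat n * u ^ n / u"
      using u by (cases n) auto
    then have f': "deriv f z = (deriv g z + of_nat n * g z / u) * u ^ n"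
      unfolding f' u_def[symmetric] by (simp add: algebra_simps)
    have fz: "f z = g z * u ^ n" "g z \<noteq> 0"
      using z fg[of z] by (auto simp: u_def)
    have "starlike_quot f z = z * (deriv g z + of_nat n * g z / u) / g z"
      unfolding starlike_quot_def f' fz(1) using u by simp
    also have "\<dots> = k z / u"
      unfolding k_def u_def[symmetric] using u fz(2) by (simp add: divide_simps mult_ac)
    finally show "starlike_quot f z = k z / (z - \<xi>)" by (simp add: u_def)
  qed (use r in \<open>auto simp: k_def\<close>)
qed

text \<open>Near \<xi> the second derivative has leading term
  \<open>2 k(\<xi>) / (z - \<xi>)^3\<close>, while the first has at most a double pole; the cubic
  factor isolates the former.\<close>

lemma simple_pole_second_order_limit:
  fixes k P :: "complex \<Rightarrow> complex"
  assumes k: "k holomorphic_on ball \<xi> r" and r: "r > 0"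
    and P: "\<And>z. z \<in> ball \<xi> r - {\<xi>} \<Longrightarrow> P z = k z / (z - \<xi>)"
  shows "((\<lambda>z. (z - \<xi>) ^ 3 * (b * (z * deriv P z) + c * (z\<^sup>2 * deriv (deriv P) z)))
           \<longlongrightarrow> 2 * c * \<xi>\<^sup>2 * k \<xi>) (at \<xi>)"
proof -
  let ?B = "ball \<xi> r - {\<xi>}"
  have opB: "open ?B" by auto
  have k': "deriv k holomorphic_on ball \<xi> r" by (intro holomorphic_intros k) auto
  have k'': "deriv (deriv k) holomorphic_on ball \<xi> r" by (intro holomorphic_intros k') auto
  note D = holomorphic_derivI[OF k open_ball] holomorphic_derivI[OF k' open_ball]
  let ?i = "\<lambda>z. inverse (z - \<xi>)"
  let ?P' = "\<lambda>z. deriv k z * ?i z - k z * (?i z)\<^sup>2"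
  let ?P'' = "\<lambda>z. deriv (deriv k) z * ?i z - 2 * deriv k z * (?i z)\<^sup>2 + 2 * k z * (?i z) ^ 3"
  have P': "deriv P z = ?P' z" if z: "z \<in> ?B" for z
  proof -
    have nz: "z - \<xi> \<noteq> 0" and zB: "z \<in> ball \<xi> r" using z by auto
    have "deriv P z = deriv (\<lambda>z. k z * ?i z) z"
      by (intro deriv_cong_ev eventually_nhds_in_open[OF opB, THEN eventually_mono])
        (use z P in \<open>auto simp: divide_inverse\<close>)
    also have "\<dots> = ?P' z"
      by (rule DERIV_imp_deriv, (rule derivative_eq_intros D refl nz zB)+)
        (simp add: algebra_simps power2_eq_square)
    finally show ?thesis .
  qed
  have P'': "deriv (deriv P) z = ?P'' z" if z: "z \<in> ?B" for z
  proof -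
    have nz: "z - \<xi> \<noteq> 0" and zB: "z \<in> ball \<xi> r" using z by auto
    have "deriv (deriv P) z = deriv ?P' z"
      by (intro deriv_cong_ev eventually_nhds_in_open[OF opB, THEN eventually_mono]) (use z P' in auto)
    also have "\<dots> = ?P'' z"
      by (rule DERIV_imp_deriv, (rule derivative_eq_intros D refl nz zB)+)
        (simp add: algebra_simps power2_eq_square power3_eq_cube)
    finally show ?thesis .
  qed
  \<comment> \<open>The expression with its denominators cleared: it is continuous at \<xi>, where
    only the term with \<open>2 * k z\<close> survives.\<close>
  let ?H = "\<lambda>z. b * z * ((z - \<xi>)\<^sup>2 * deriv k z - (z - \<xi>) * k z)
     + c * z\<^sup>2 * ((z - \<xi>)\<^sup>2 * deriv (deriv k) z - 2 * (z - \<xi>) * deriv k z + 2 * k z)"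
  have "isCont k \<xi>" "isCont (deriv k) \<xi>" "isCont (deriv (deriv k)) \<xi>"
    using k k' k'' r
    by (auto intro!: continuous_on_interior holomorphic_on_imp_continuous_on)
  then have "isCont ?H \<xi>" by (intro continuous_intros)
  then have "(?H \<longlongrightarrow> 2 * c * \<xi>\<^sup>2 * k \<xi>) (at \<xi>)"
    by (simp add: isCont_def mult_ac)
  moreover have "eventually (\<lambda>z. ?H z =
      (z - \<xi>) ^ 3 * (b * (z * deriv P z) + c * (z\<^sup>2 * deriv (deriv P) z))) (at \<xi>)"
  proof -
    have "eventually (\<lambda>z. z \<in> ?B) (at \<xi>)"
      using r eventually_at_in_open[of "ball \<xi> r" \<xi>] by simp
    then show ?thesis
    proof eventually_elim
      case (elim z)
      then have u: "(z - \<xi>) * ?i z = 1" by auto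
      have eqs: "(z - \<xi>) ^ 3 * ?P' z = (z - \<xi>)\<^sup>2 * deriv k z - (z - \<xi>) * k z"
        "(z - \<xi>) ^ 3 * ?P'' z
         = (z - \<xi>)\<^sup>2 * deriv (deriv k) z - 2 * (z - \<xi>) * deriv k z + 2 * k z"
        using u by algebra+
      have "x * (b * (z * A) + c * (z\<^sup>2 * B)) = b * z * (x * A) + c * z\<^sup>2 * (x * B)" for x A B
        by (simp add: algebra_simps)
      then show ?case
        by (simp only: P'[OF elim] P''[OF elim] eqs)
    qed
  qed
  ultimately show ?thesis by (rule Lim_transform_eventually)
qed

text \<open>Away from the origin, a genuine simple pole of the quotient would force a triple pole of
  \<open>G\<close>, against its continuity. At the origin the local form already has
  \<open>k \<xi> = 0\<close>.\<close>

lemma starlike_quot_extends: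
  assumes f: "f holomorphic_on S" "open S" "connected S" "\<xi> \<in> S" and nz: "\<exists>w\<in>S. f w \<noteq> 0"
    and c: "c \<noteq> 0" and G: "isCont G \<xi>"
    and eq: "eventually (\<lambda>z. G z = b * (z * deriv (starlike_quot f) z)
               + c * (z\<^sup>2 * deriv (deriv (starlike_quot f)) z)) (at \<xi>)"
  shows "remove_sings (starlike_quot f) analytic_on {\<xi>}"
proof -
  let ?P = "starlike_quot f"
  obtain k r where r: "r > 0" and k: "k holomorphic_on ball \<xi> r" and k0: "\<xi> = 0 \<Longrightarrow> k \<xi> = 0"
    and P: "\<And>z. z \<in> ball \<xi> r - {\<xi>} \<Longrightarrow> ?P z = k z / (z - \<xi>)"
    using starlike_quot_local_form[OF f nz] by blast
  have "((\<lambda>z. (z - \<xi>) ^ 3 * G z) \<longlongrightarrow> 2 * c * \<xi>\<^sup>2 * k \<xi>) (at \<xi>)"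
    by (rule Lim_transform_eventually[OF simple_pole_second_order_limit[OF k r P, of b c]])
      (assumption, rule eventually_mono[OF eq], simp)
  \<comment> \<open>Continuity of \<open>G\<close> makes the same limit zero, so the pole
    coefficient must vanish.\<close>
  moreover have "((\<lambda>z. (z - \<xi>) ^ 3 * G z) \<longlongrightarrow> (\<xi> - \<xi>) ^ 3 * G \<xi>) (at \<xi>)"
    using G unfolding isCont_def by (intro tendsto_intros)
  ultimately have "2 * c * \<xi>\<^sup>2 * k \<xi> = (\<xi> - \<xi>) ^ 3 * G \<xi>"
    by (rule tendsto_unique[OF trivial_limit_at])
  then have k\<xi>: "k \<xi> = 0"
    using c k0 by auto
  have evB: "eventually (\<lambda>z. z \<in> ball \<xi> r - {\<xi>}) (at \<xi>)"
    using r eventually_at_in_open[of "ball \<xi> r" \<xi>] by simp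
  show ?thesis
  proof (rule remove_sings_analytic_at)
    have "(\<lambda>z. k z / (z - \<xi>)) holomorphic_on ball \<xi> r - {\<xi>}"
      by (intro holomorphic_intros holomorphic_on_subset[OF k]) auto
    then have "?P holomorphic_on ball \<xi> r - {\<xi>}"
      by (rule holomorphic_transform) (simp add: P)
    then show "isolated_singularity_at ?P \<xi>"
      by (rule isolated_singularity_at_holomorphic) (use r in auto)
    \<comment> \<open>As \<open>k \<xi> = 0\<close>, the local form is the difference quotient of
      \<open>k\<close> at \<xi>.\<close>
    have "(k has_field_derivative deriv k \<xi>) (at \<xi>)"
      by (rule holomorphic_derivI[OF k]) (use r in auto)
    then have "((\<lambda>z. k z / (z - \<xi>)) \<longlongrightarrow> deriv k \<xi>) (at \<xi>)"
      by (simp add: has_field_derivative_iff k\<xi>)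
    then show "?P \<midarrow>\<xi>\<rightarrow> deriv k \<xi>"
      by (rule Lim_transform_eventually) (rule eventually_mono[OF evB], simp add: P)
  qed
qed

theorem theorem4p6:
  fixes f :: "complex \<Rightarrow> complex" and \<beta> \<gamma> :: real
  assumes "f \<in> class_A"
    and "\<gamma> \<ge> \<beta>" and "\<beta> > 0" and "4 * \<gamma> - \<beta> \<ge> 1"
    and "remove_sings (\<lambda>z.
           of_real \<gamma> * (z * deriv f z / f z) *
             (1 + z * (deriv ^^ 2) f z / deriv f z - z * deriv f z / f z)
         + of_real \<beta> * (z * deriv f z / f z) *
             (z ^ 2 * (deriv ^^ 3) f z / deriv f z - 3 * z ^ 2 * (deriv ^^ 2) f z / f z
              + 2 * z * (deriv ^^ 2) f z / deriv f z
              + 2 * (z * deriv f z / f z) ^ 2 - 2 * z * deriv f z / f z))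
         \<prec>\<^sub>s (\<lambda>z. z / (8 * of_real (sqrt 2)))"
  shows "f \<in> class_SL"
proof -
  define F where "F = second_order_functional \<gamma> \<beta> f"
  define G where "G = remove_sings F"
  define P where "P = starlike_quot f"
  define p where "p = remove_sings P"
  define M where "M = 1 / (8 * sqrt 2)"
  have "G \<prec>\<^sub>s (\<lambda>z. z / (8 * of_real (sqrt 2)))"
    using assms(5) unfolding G_def F_def second_order_functional_def .
  then obtain w where G: "G holomorphic_on \<D>" and w: "w holomorphic_on \<D>" "w \<in> \<D> \<rightarrow> \<D>" "w 0 = 0"
    and Gw: "\<And>z. z \<in> \<D> \<Longrightarrow> G z = w z / (8 * of_real (sqrt 2))"
    unfolding subordinate_def by blast
  \<comment> \<open>Schwarz's lemma retains the factor \<open>norm z\<close>, which later cancels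
    against the factor \<open>z\<close> in \<open>G z = z * ?q z\<close>.\<close>
  have G_le: "norm (G z) \<le> M * norm z" if "z \<in> \<D>" for z
  proof -
    have "norm (w z) \<le> norm z"
      by (rule Schwarz_Lemma(1)[OF w(1,3)]) (use w(2) that in auto)
    then show ?thesis
      by (simp add: Gw[OF that] M_def norm_divide norm_mult divide_right_mono)
  qed

  \<comment> \<open>Holomorphic extension of \<open>z f' / f\<close> to the disc\<close>
  have f: "f holomorphic_on \<D>" "f 0 = 0" "deriv f 0 = 1"
    using assms(1) by (auto simp: class_A_def)
  have f': "deriv f holomorphic_on \<D>" by (intro holomorphic_intros f) auto
  have f_nz: "\<exists>z\<in>\<D>. f z \<noteq> 0"
  proof (rule ccontr)
    assume "\<not> ?thesis"
    then have "deriv f 0 = deriv (\<lambda>_. 0) 0"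
      by (intro deriv_cong_ev eventually_nhds_in_open[of \<D>, THEN eventually_mono]) auto
    then show False using f by simp
  qed
  \<comment> \<open>All denominators are nonzero on \<open>T\<close>. Neither \<open>f\<close> nor
    \<open>deriv f\<close> vanishes identically, so their zeros are isolated and \<open>T\<close>
    contains a punctured neighbourhood of every point of the disc.\<close>
  define T where "T = {z \<in> \<D>. f z \<noteq> 0 \<and> deriv f z \<noteq> 0}"
  have ev_T: "eventually (\<lambda>z. z \<in> T) (at \<xi>)" if "\<xi> \<in> \<D>" for \<xi>
  proof -
    obtain z where "z \<in> \<D>" "f z \<noteq> 0" using f_nz by blast
    from non_zero_neighbour_alt[OF f(1) open_ball connected_ball that this]
      non_zero_neighbour_alt[OF f' open_ball connected_ball that, of 0]
    show ?thesis
      using f(3) by (auto simp: T_def eventually_conj_iff elim: eventually_elim2)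
  qed
  have ana: "f analytic_on {z}" if "z \<in> T" for z
    using that f(1) unfolding T_def analytic_at by (auto intro!: exI[of _ \<D>])
  have G_T: "G z = of_real \<gamma> * (z * deriv P z) + of_real \<beta> * (z\<^sup>2 * deriv (deriv P) z)"
    if "z \<in> T" for z
  proof -
    have "F analytic_on {z}"
      unfolding F_def second_order_functional_def
      using that by (intro analytic_intros ana) (auto simp: T_def)
    then have "G z = F z" by (simp add: G_def)
    also have "\<dots> = of_real \<gamma> * (z * deriv P z) + of_real \<beta> * (z\<^sup>2 * deriv (deriv P) z)"
      unfolding F_def P_def
      by (rule second_order_functional_eq[OF f(1) open_ball]) (use that in \<open>auto simp: T_def\<close>)
    finally show ?thesis .
  qed
  have isCont_D: "isCont h \<xi>" if "h holomorphic_on \<D>" "\<xi> \<in> \<D>" for h \<xi>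
    using that by (auto intro!: continuous_on_interior holomorphic_on_imp_continuous_on)
  have "p analytic_on {\<xi>}" if "\<xi> \<in> \<D>" for \<xi>
    unfolding p_def P_def
  \<comment> \<open>The coefficient of the second derivative is \<beta>, which is nonzero; this is
    what excludes poles.\<close>
  proof (rule starlike_quot_extends[OF f(1) open_ball connected_ball that f_nz, of "of_real \<beta>" G "of_real \<gamma>"])
    show "eventually (\<lambda>z. G z = of_real \<gamma> * (z * deriv (starlike_quot f) z)
        + of_real \<beta> * (z\<^sup>2 * deriv (deriv (starlike_quot f)) z)) (at \<xi>)"
      using ev_T[OF that] by eventually_elim (use G_T in \<open>simp add: P_def\<close>)
  qed (use assms(3) isCont_D[OF G that] in auto)
  then have p: "p holomorphic_on \<D>"
    using analytic_on_analytic_at analytic_imp_holomorphic by blast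
  have p': "deriv p holomorphic_on \<D>" by (intro holomorphic_intros p) auto
  have p'': "deriv (deriv p) holomorphic_on \<D>" by (intro holomorphic_intros p') auto

  \<comment> \<open>Bound on the derivative of \<open>p\<close>\<close>
  let ?q = "\<lambda>z. of_real \<gamma> * deriv p z + of_real \<beta> * z * deriv (deriv p) z"
  have q: "?q holomorphic_on \<D>" by (intro holomorphic_intros p' p'')
  have q_T: "norm (?q z) \<le> M" if z: "z \<in> T" "z \<noteq> 0" for z
  proof -
    have "P analytic_on {z}"
      unfolding P_def starlike_quot_def
      using z by (intro analytic_intros ana) (auto simp: T_def)
    from eventually_remove_sings_eq_nhds[OF this]
    have "eventually (\<lambda>w. p w = P w) (nhds z)" by (simp add: p_def)
    from higher_deriv_cong_ev[OF this refl, of 1] higher_deriv_cong_ev[OF this refl, of 2]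
    have "deriv p z = deriv P z" "deriv (deriv p) z = deriv (deriv P) z"
      by (simp_all add: numeral_2_eq_2)
    then have "G z = z * ?q z"
      using G_T[OF z(1)] by (simp add: algebra_simps power2_eq_square)
    then have "norm z * norm (?q z) \<le> norm z * M"
      using G_le[of z] z by (simp add: T_def norm_mult mult_ac)
    then show ?thesis using z by simp
  qed
  \<comment> \<open>The bound passes to the exceptional points by continuity of
    \<open>?q\<close>.\<close>
  have "norm (?q \<xi>) \<le> M" if "\<xi> \<in> \<D>" for \<xi>
  proof (rule Lim_norm_ubound[OF trivial_limit_at])
    show "?q \<midarrow>\<xi>\<rightarrow> ?q \<xi>"
      using isCont_D[OF q that] by (simp only: isCont_def)
    have "eventually (\<lambda>z. z \<noteq> 0) (at \<xi>)"
      by (cases "\<xi> = 0") (auto simp: eventually_neq_at_within intro: eventually_at_topological[THEN iffD2])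
    with ev_T[OF that] show "eventually (\<lambda>z. norm (?q z) \<le> M) (at \<xi>)"
      by eventually_elim (rule q_T)
  qed
  \<comment> \<open>Here \<open>4 * \<gamma> \<ge> 1 + \<beta> > 1\<close>.\<close>
  moreover have \<gamma>: "\<gamma> > 1 / 4" using assms by linarith
  ultimately have p'_le: "norm (deriv p z) \<le> M / \<gamma>" if "z \<in> \<D>" for z
    using first_order_operator_bound[OF p' assms(3) _ _ that] by simp

  \<comment> \<open>Distance of \<open>p\<close> from \<open>1\<close>\<close>
  have "p 0 = 1"
    unfolding p_def
  proof (rule remove_sings_eqI)
    have "(f has_field_derivative 1) (at 0)"
      using holomorphic_derivI[OF f(1) open_ball, of 0] f(3) by simp
    then have "(\<lambda>z. f z / z) \<midarrow>0\<rightarrow> 1"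
      by (simp add: has_field_derivative_iff f(2))
    moreover have "deriv f \<midarrow>0\<rightarrow> 1"
      using isCont_D[OF f', of 0] f(3) by (simp add: isCont_def)
    \<comment> \<open>Dividing numerator and denominator by \<open>z\<close> resolves the form 0/0;
      both limits equal \<open>deriv f 0\<close>.\<close>
    ultimately have "(\<lambda>z. deriv f z / (f z / z)) \<midarrow>0\<rightarrow> 1 / 1"
      by (intro tendsto_intros) auto
    then show "P \<midarrow>0\<rightarrow> 1"
      by (simp add: P_def starlike_quot_def[abs_def] mult.commute)
  qed
  have p1: "norm (p z - 1) < 2 / 5" if z: "z \<in> \<D>" for z
  proof -
    have "norm (p z - p 0) \<le> M / \<gamma> * norm (z - 0)"
      by (rule field_differentiable_bound[of \<D> p "deriv p"])
        (use z p'_le in \<open>auto intro!: holomorphic_derivI[OF p]\<close>)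
    also have "\<dots> \<le> M / \<gamma> * 1"
      using z \<gamma> by (intro mult_left_mono) (auto simp: M_def)
    also have "\<dots> \<le> M / (1 / 4)"
      using \<gamma> unfolding mult_1_right by (intro divide_left_mono) (auto simp: M_def)
    \<comment> \<open>The left side is \<open>1 / (2 * sqrt 2)\<close>, so this amounts to
      \<open>sqrt 2 > 5 / 4\<close>.\<close>
    also have "\<dots> < 2 / 5"
    proof -
      have "sqrt 2 > 5 / 4" by (rule real_less_rsqrt) (simp add: power2_eq_square)
      then show ?thesis by (simp add: M_def field_simps)
    qed
    finally show ?thesis by (simp add: \<open>p 0 = 1\<close>)
  qed

  \<comment> \<open>Subordination, with the witness \<open>v\<close> found by solving
    \<open>p = csqrt (1 + v)\<close>\<close>
  define v where "v = (\<lambda>z. (p z)\<^sup>2 - 1)"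
  have v_le: "norm (v z) < 1" if z: "z \<in> \<D>" for z
  proof -
    have "norm (p z + 1) \<le> norm (p z - 1) + 2"
      using norm_triangle_ineq[of "p z - 1" 2] by (simp add: add.commute)
    \<comment> \<open>The bound on the right is \<open>24 / 25\<close>, below
      \<open>1\<close>.\<close>
    then have "norm (p z - 1) * norm (p z + 1) \<le> 2 / 5 * (2 / 5 + 2)"
      using p1[OF z] by (intro mult_mono) auto
    moreover have "v z = (p z - 1) * (p z + 1)"
      by (simp add: v_def algebra_simps power2_eq_square)
    ultimately show ?thesis by (simp add: norm_mult)
  qed
  have p_sqrt: "p z = csqrt (1 + v z)" if z: "z \<in> \<D>" for z
  proof -
    \<comment> \<open>Lying in the right half-plane selects the principal branch, so
      \<open>csqrt\<close> undoes the squaring.\<close>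
    have "Re (p z) > 0"
      using p1[OF z] abs_Re_le_cmod[of "p z - 1"] by simp
    then show ?thesis by (simp add: v_def csqrt_square)
  qed
  have "p \<prec>\<^sub>s (\<lambda>z. csqrt (1 + z))"
    unfolding subordinate_def
  proof (intro conjI exI ballI)
    show "(\<lambda>z. csqrt (1 + z)) holomorphic_on \<D>"
    proof (intro holomorphic_intros)
      fix z :: complex assume "z \<in> \<D>"
      then have "Re (1 + z) > 0" using abs_Re_le_cmod[of z] by simp
      then show "1 + z \<notin> \<real>\<^sub>\<le>\<^sub>0" by (auto simp: complex_nonpos_Reals_iff)
    qed
    show "v holomorphic_on \<D>" unfolding v_def by (intro holomorphic_intros p)
    show "v 0 = 0" by (simp add: v_def \<open>p 0 = 1\<close>)
  qed (use p v_le p_sqrt in auto)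
  then show ?thesis
    using assms(1) by (simp add: class_SL_def p_def P_def)
qed

end
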